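(* Let $\Gamma$ be a compact connected metric graph of genus $g\ge 2$. Fix a point $v_0\in\Gamma$. Let $D\in\mathrm{Div}(\Gamma)$ be a $v_0$-reduced divisor on $\Gamma$, and let $D(v_0)$ denote the coefficient of $D$ at $v_0$. If $\deg(D)-D(v_0)\le g-1$, then there exists $w\in\Gamma\setminus\{v_0\}$ such that $D+[w]$ is a $v_0$-reduced divisor.
   Context: A compact connected metric graph $\Gamma$ is the underlying metric space of a finite connected multigraph (loops allowed) each of whose edges is assigned a positive length; its genus is its first Betti number. $\mathrm{Div}(\Gamma)$ is the free abelian group on the points of $\Gamma$; for $D=\sum_v n_v[v]$, $\deg D=\sum_v n_v$ and $D(v)=n_v$. For a closed subset $A\subseteq\Gamma$ and $v\in\Gamma$, the out-degree $\mathrm{outdeg}^\Gamma_A(v)$ is the maximum number of internally disjoint segments of $\Gamma\setminus A$ with an open end $v$. For $D\in\mathrm{Div}(\Gamma)$, a point $v\in\partial A$ is saturated for $D$ with respect to $A$ if $D(v)\ge\mathrm{outdeg}^\Gamma_A(v)$, and non-saturated otherwise. A divisor $D$ is $v_0$-reduced if $D(v)\ge 0$ for all $v\in\Gamma\setminus\{v_0\}$ and every non-empty compact subset $A$ of $\Gamma\setminus\{v_0\}$ contains a point $v\in\partial A$ that is non-saturated for $D$ with respect to $A$. *)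

theory Defs
  imports
    "Graph_Theory.Digraph_Component"
    "HOL-Analysis.Analysis"
    "HOL-Analysis.Finite_Function_Topology"
    "HOL-Library.Poly_Mapping"
begin

text \<open>
  A finite multigraph with loops is a \<^locale>\<open>fin_digraph\<close> whose orientation is
  arbitrary and serves only to parametrize each edge \<open>e\<close> by \<open>[0, len e]\<close>, from tail to head.
  The metric graph itself is the whole type \<open>'a\<close>; its vertices are points of \<open>'a\<close>, and
  \<open>emb e t\<close> is the point at distance \<open>t\<close> along \<open>e\<close> from the tail.
\<close>

text \<open>
  \<open>route G len emb x y l\<close>: one can get from \<open>x\<close> to \<open>y\<close> by finitely many moves,
  each inside a single edge, of total length \<open>l\<close>.
\<close>

inductive route ::
  "('a, 'e) pre_digraph \<Rightarrow> ('e \<Rightarrow> real) \<Rightarrow> ('e \<Rightarrow> real \<Rightarrow> 'a) \<Rightarrow> 'a \<Rightarrow> 'a \<Rightarrow> real \<Rightarrow> bool"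
  for G len emb
where
  refl: "route G len emb x x 0"
| step: "route G len emb x (emb e s) l \<Longrightarrow> e \<in> arcs G \<Longrightarrow> s \<in> {0..len e} \<Longrightarrow> t \<in> {0..len e}
    \<Longrightarrow> route G len emb x (emb e t) (l + \<bar>t - s\<bar>)"

text \<open>
  The space is the disjoint union of the vertices and of the intervals \<open>[0, len e]\<close> with
  their ends glued to the vertices, and \<open>dist\<close> is the resulting shortest-path metric.
\<close>

locale metric_graph = fin_digraph G
  for G :: "('a::metric_space, 'e) pre_digraph" +
  fixes len :: "'e \<Rightarrow> real"
    and emb :: "'e \<Rightarrow> real \<Rightarrow> 'a"
  assumes graph_connected: "Digraph_Component.connected G"
    and len_pos: "e \<in> arcs G \<Longrightarrow> 0 < len e"
    and emb_tail: "e \<in> arcs G \<Longrightarrow> emb e 0 = tail G e"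
    and emb_head: "e \<in> arcs G \<Longrightarrow> emb e (len e) = head G e"
    and emb_inj: "inj_on (\<lambda>(e, t). emb e t) (SIGMA e:arcs G. {0<..<len e})"
    and emb_interior: "e \<in> arcs G \<Longrightarrow> t \<in> {0<..<len e} \<Longrightarrow> emb e t \<notin> verts G"
    and covered: "verts G \<union> (\<Union>e\<in>arcs G. emb e ` {0..len e}) = UNIV"
    and dist_eq: "dist x y = Inf {l. route G len emb x y l}"

text \<open>
  The first Betti number is the dimension of the first homology with real coefficients of the
  one-dimensional cell complex \<open>G\<close>. As there are no 2-cells, this homology is the kernel of the
  boundary map on 1-chains.
\<close>

definition boundary_map :: "('a, 'e) pre_digraph \<Rightarrow> ('e \<Rightarrow>\<^sub>0 real) \<Rightarrow> ('a \<Rightarrow>\<^sub>0 real)" where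
  "boundary_map G c = (\<Sum>e\<in>Poly_Mapping.keys c. Poly_Mapping.lookup c e *\<^sub>R
     (Poly_Mapping.single (head G e) 1 - Poly_Mapping.single (tail G e) 1))"

definition cycle_space :: "('a, 'e) pre_digraph \<Rightarrow> ('e \<Rightarrow>\<^sub>0 real) set" where
  "cycle_space G = {c. Poly_Mapping.keys c \<subseteq> arcs G \<and> boundary_map G c = 0}"

definition genus :: "('a, 'e) pre_digraph \<Rightarrow> nat" where
  "genus G = dim (cycle_space G)"

type_synonym 'a divisor = "'a \<Rightarrow>\<^sub>0 int"

definition divisor_degree :: "'a divisor \<Rightarrow> int" where
  "divisor_degree D = (\<Sum>v\<in>Poly_Mapping.keys D. Poly_Mapping.lookup D v)"

text \<open>
  A segment of \<open>- A\<close> with open end \<open>v\<close> is an arc that starts at \<open>v\<close> and avoids \<open>A\<close> except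
  possibly at \<open>v\<close>. On a metric graph the families below have bounded size, so that the
  maximum exists.
\<close>

definition outdeg :: "'a::metric_space set \<Rightarrow> 'a \<Rightarrow> nat" where
  "outdeg A v = Max {card F |F :: (real \<Rightarrow> 'a) set. finite F \<and>
     (\<forall>\<gamma>\<in>F. Path_Connected.arc \<gamma> \<and> pathstart \<gamma> = v \<and> \<gamma> ` {0<..1} \<subseteq> - A) \<and>
     disjoint_family_on (\<lambda>\<gamma>. \<gamma> ` {0<..<1}) F}"

definition saturated :: "'a::metric_space divisor \<Rightarrow> 'a set \<Rightarrow> 'a \<Rightarrow> bool" where
  "saturated D A v \<longleftrightarrow> int (outdeg A v) \<le> Poly_Mapping.lookup D v"

definition v0_reduced :: "'a::metric_space \<Rightarrow> 'a divisor \<Rightarrow> bool" where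
  "v0_reduced v\<^sub>0 D \<longleftrightarrow>
     (\<forall>v. v \<noteq> v\<^sub>0 \<longrightarrow> 0 \<le> Poly_Mapping.lookup D v) \<and>
     (\<forall>A. A \<noteq> {} \<longrightarrow> compact A \<longrightarrow> A \<subseteq> - {v\<^sub>0} \<longrightarrow> (\<exists>v\<in>frontier A. \<not> saturated D A v))"

end

theory Submission
  imports Defs
begin

text \<open>
  The proof is the count behind Dhar's burning algorithm.  Cut the metric graph at finitely many
  points, among them \<open>v\<^sub>0\<close>, the support of \<open>D\<close> and the midpoints of the edges, into a finite graph
  without loops.  Light a fire at \<open>v\<^sub>0\<close> and let it spread along edges; a node catches fire once the
  burning edges that reach it outnumber its chips.  A divisor that is nonnegative away from \<open>v\<^sub>0\<close> is
  reduced exactly if everything burns.  If the fire stops, the unburnt nodes with the edges between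
  them form a closed set whose boundary points are all saturated (\<open>reduced_imp_burnt\<close>).  Conversely,
  if everything burns and \<open>A\<close> is a nonempty closed set that avoids \<open>v\<^sub>0\<close>, the fire enters \<open>A\<close> at a
  boundary point that is not saturated (\<open>burnt_imp_reduced\<close>).

  Every edge carries the fire to exactly one node, namely the end that burns later.  A node \<open>v\<close> other
  than \<open>v\<^sub>0\<close> receives at least \<open>D(v) + 1\<close> edges, while the number of all edges minus the number
  of nodes other than \<open>v\<^sub>0\<close> is the genus \<open>g\<close>.  Since \<open>D\<close> has fewer than \<open>g\<close> chips away from
  \<open>v\<^sub>0\<close>, some node \<open>w\<close> receives an edge more than it needs, and the same fire still burns
  everything when \<open>w\<close> is given one more chip (\<open>burnt_add_chip\<close>).  Then \<open>D + [w]\<close> is reduced.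

  Three facts connect this count with the metric space.  Open segments of edges are open sets
  (\<open>open_segment_of_edge\<close>), by means of Lipschitz functions on the graph.  An out-degree is at most
  the number of incident edges that leave the set (\<open>outdeg_le\<close>), because two arcs that enter the
  same edge from the same end must meet.  The genus, as the dimension of the cycle space, is at most
  the number of edges minus the number of vertices plus one (\<open>genus_le\<close>), because a cycle is
  determined by its coefficients outside a spanning tree.
\<close>

section \<open>Subarcs\<close>

abbreviation open_image :: "(real \<Rightarrow> 'a) \<Rightarrow> 'a set" where
  "open_image \<sigma> \<equiv> \<sigma> ` {0<..<1}"

text \<open>
  The analogue of \<open>subpath\<close> for points that do not form a normed vector space.
\<close>

definition subarc :: "real \<Rightarrow> real \<Rightarrow> (real \<Rightarrow> 'a) \<Rightarrow> real \<Rightarrow> 'a" where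
  "subarc a b \<gamma> = (\<lambda>x. \<gamma> (a + (b - a) * x))"

lemma affine_image_Icc:
  fixes a b :: real
  assumes "a < b"
  shows "(\<lambda>x. a + (b - a) * x) ` {0..1} = {a..b}"
proof (intro equalityI subsetI)
  fix y assume "y \<in> {a..b}"
  then show "y \<in> (\<lambda>x. a + (b - a) * x) ` {0..1}"
    using assms by (intro image_eqI[where x = "(y - a) / (b - a)"]) (auto simp: field_simps)
next
  fix y assume "y \<in> (\<lambda>x. a + (b - a) * x) ` {0..1}"
  then obtain x where x: "y = a + (b - a) * x" "x \<in> {0..1}" by (rule imageE)
  have "(b - a) * x \<le> (b - a) * 1" "0 \<le> (b - a) * x"
    using x assms by (intro mult_left_mono mult_nonneg_nonneg; simp)+
  then show "y \<in> {a..b}" unfolding x(1) mult_1_right by simp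
qed

lemma affine_image_Ioo:
  fixes a b :: real
  assumes "a < b"
  shows "(\<lambda>x. a + (b - a) * x) ` {0<..<1} = {a<..<b}"
proof (intro equalityI subsetI)
  fix y assume "y \<in> {a<..<b}"
  then show "y \<in> (\<lambda>x. a + (b - a) * x) ` {0<..<1}"
    using assms by (intro image_eqI[where x = "(y - a) / (b - a)"]) (auto simp: field_simps)
next
  fix y assume "y \<in> (\<lambda>x. a + (b - a) * x) ` {0<..<1}"
  then obtain x where x: "y = a + (b - a) * x" "x \<in> {0<..<1}" by (rule imageE)
  have "(b - a) * x < (b - a) * 1" "0 < (b - a) * x"
    using x assms by (intro mult_strict_left_mono mult_pos_pos; simp)+
  then show "y \<in> {a<..<b}" unfolding x(1) mult_1_right by simp
qed

lemma path_image_subarc: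
  assumes "a < b"
  shows "path_image (subarc a b \<gamma>) = \<gamma> ` {a..b}"
  unfolding path_image_def subarc_def affine_image_Icc[OF assms, symmetric] image_image ..

lemma open_image_subarc:
  assumes "a < b"
  shows "open_image (subarc a b \<gamma>) = \<gamma> ` {a<..<b}"
  unfolding subarc_def affine_image_Ioo[OF assms, symmetric] image_image ..

lemma pathstart_subarc [simp]: "pathstart (subarc a b \<gamma>) = \<gamma> a"
  by (simp add: pathstart_def subarc_def)

lemma pathfinish_subarc [simp]: "pathfinish (subarc a b \<gamma>) = \<gamma> b"
  by (simp add: pathfinish_def subarc_def)

lemma arc_subarc:
  fixes \<gamma> :: "real \<Rightarrow> 'a::topological_space"
  assumes "a < b" "continuous_on {a..b} \<gamma>" "inj_on \<gamma> {a..b}"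
  shows "Path_Connected.arc (subarc a b \<gamma>)"
proof -
  let ?f = "\<lambda>x. a + (b - a) * x"
  have "continuous_on {0..1} (\<gamma> \<circ> ?f)"
    using assms by (intro continuous_on_compose continuous_intros) (simp add: affine_image_Icc)
  moreover have "inj_on (\<gamma> \<circ> ?f) {0..1}"
    using assms by (intro comp_inj_on) (auto simp: affine_image_Icc inj_on_def)
  ultimately show ?thesis
    by (simp add: Path_Connected.arc_def path_def subarc_def comp_def)
qed

lemma open_image_reversepath [simp]: "open_image (reversepath \<sigma>) = open_image \<sigma>"
proof -
  have "open_image (reversepath \<tau>) \<subseteq> open_image \<tau>" for \<tau> :: "real \<Rightarrow> 'a"
    by (auto simp: reversepath_def)
  from this[of \<sigma>] this[of "reversepath \<sigma>"] show ?thesis by simp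
qed

lemma path_image_eq_open_image:
  "path_image \<sigma> = {pathstart \<sigma>, pathfinish \<sigma>} \<union> open_image \<sigma>"
proof -
  have "{0..1::real} = {0, 1} \<union> {0<..<1}" by auto
  then show ?thesis unfolding path_image_def pathstart_def pathfinish_def by auto
qed

section \<open>Decompositions into arcs\<close>

text \<open>
  A finite loopless topological model of a metric graph.  Edge lengths are forgotten: it is
  enough that edges are arcs with open interiors, because out-degrees are topological.
\<close>

locale arc_decomposition =
  fixes W :: "'a::metric_space set" and S :: "(real \<Rightarrow> 'a) set"
  assumes finite_nodes: "finite W"
    and finite_edges: "finite S"
    and edge_arc: "\<sigma> \<in> S \<Longrightarrow> Path_Connected.arc \<sigma>"
    and edge_start: "\<sigma> \<in> S \<Longrightarrow> pathstart \<sigma> \<in> W"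
    and edge_finish: "\<sigma> \<in> S \<Longrightarrow> pathfinish \<sigma> \<in> W"
    and edge_open: "\<sigma> \<in> S \<Longrightarrow> open (open_image \<sigma>)"
    and edge_avoids_nodes: "\<sigma> \<in> S \<Longrightarrow> open_image \<sigma> \<inter> W = {}"
    and edge_disjoint: "\<sigma> \<in> S \<Longrightarrow> \<tau> \<in> S \<Longrightarrow> \<sigma> \<noteq> \<tau> \<Longrightarrow> open_image \<sigma> \<inter> open_image \<tau> = {}"
    and cover: "W \<union> (\<Union>\<sigma>\<in>S. path_image \<sigma>) = UNIV"
begin

lemma point_cases:
  obtains "x \<in> W" | \<sigma> where "\<sigma> \<in> S" "x \<in> open_image \<sigma>"
proof -
  have "x \<in> W \<union> (\<Union>\<sigma>\<in>S. path_image \<sigma>)" using cover by auto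
  then show ?thesis
    using that edge_start edge_finish by (auto simp: path_image_eq_open_image)
qed

lemma ends_distinct: "\<sigma> \<in> S \<Longrightarrow> pathfinish \<sigma> \<noteq> pathstart \<sigma>"
  by (metis edge_arc arc_distinct_ends)

text \<open>
  Near its start, an arc runs inside a single open edge: it is a connected subset of the union of
  the disjoint open sets \<open>open_image \<sigma>\<close>, once it is too short to reach what is not incident to \<open>v\<close>.
\<close>

lemma arc_enters_edge:
  assumes v: "v \<in> W" and \<gamma>: "Path_Connected.arc \<gamma>" "pathstart \<gamma> = v"
  obtains \<sigma> \<epsilon> where "\<sigma> \<in> S" "v \<in> {pathstart \<sigma>, pathfinish \<sigma>}" "0 < \<epsilon>" "\<epsilon> < 1"
    "\<gamma> ` {0<..\<epsilon>} \<subseteq> open_image \<sigma>"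
proof -
  \<comment> \<open>Everything that is not incident to \<open>v\<close>; a small enough ball around \<open>v\<close> misses it.\<close>
  define K where "K = (W - {v}) \<union> (\<Union>\<sigma>\<in>{\<sigma>\<in>S. v \<notin> path_image \<sigma>}. path_image \<sigma>)"
  have "compact K"
    unfolding K_def using finite_nodes finite_edges edge_arc
    by (intro compact_Un compact_UN) (auto intro: finite_imp_compact compact_path_image arc_imp_path)
  then have "closed K" by (rule compact_imp_closed)
  moreover have "v \<notin> K" by (auto simp: K_def)
  ultimately obtain d where d: "d > 0" "\<And>y. dist y v < d \<Longrightarrow> y \<notin> K"
    using open_Compl[of K] unfolding open_dist by (metis Compl_iff)
  have cont: "continuous_on {0..1} \<gamma>" and inj: "inj_on \<gamma> {0..1}"
    using \<gamma> by (auto simp: Path_Connected.arc_def path_def)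
  have \<gamma>0: "\<gamma> 0 = v" using \<gamma> by (simp add: pathstart_def)
  obtain e where e: "e > 0" "\<And>t. t \<in> {0..1} \<Longrightarrow> dist t 0 < e \<Longrightarrow> dist (\<gamma> t) (\<gamma> 0) < d"
    using cont \<open>d > 0\<close> unfolding continuous_on_iff by (metis atLeastAtMost_iff order_refl zero_le_one)
  define \<epsilon> where "\<epsilon> = min (e/2) (1/2)"
  have \<epsilon>: "0 < \<epsilon>" "\<epsilon> < 1" "\<epsilon> < e" using e by (auto simp: \<epsilon>_def)
  define I where "I = \<gamma> ` {0<..\<epsilon>}"
  have I: "\<exists>\<sigma>\<in>S. v \<in> {pathstart \<sigma>, pathfinish \<sigma>} \<and> x \<in> open_image \<sigma>" if "x \<in> I" for x
  proof -
    obtain t where t: "0 < t" "t \<le> \<epsilon>" "x = \<gamma> t" using \<open>x \<in> I\<close> by (auto simp: I_def)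
    have "x \<notin> K" using t \<epsilon> e(2)[of t] d \<gamma>0 by auto
    moreover have "x \<noteq> v" using t \<epsilon> \<gamma>0 inj unfolding inj_on_def by force
    ultimately have "x \<notin> W" by (auto simp: K_def)
    then obtain \<sigma> where \<sigma>: "\<sigma> \<in> S" "x \<in> open_image \<sigma>" by (metis point_cases)
    then have "v \<in> path_image \<sigma>" using \<open>x \<notin> K\<close> by (auto simp: K_def path_image_eq_open_image)
    then show ?thesis
      using \<sigma> v edge_avoids_nodes[of \<sigma>] by (auto simp: path_image_eq_open_image)
  qed
  have "topological_space_class.connected I"
    unfolding I_def using cont \<epsilon> by (intro connected_continuous_image) (auto intro: continuous_on_subset)
  have mem: "\<gamma> \<epsilon> \<in> I" using \<epsilon> by (auto simp: I_def)
  from I[OF mem] obtain \<sigma> where \<sigma>: "\<sigma> \<in> S" "v \<in> {pathstart \<sigma>, pathfinish \<sigma>}" "\<gamma> \<epsilon> \<in> open_image \<sigma>"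
    by auto
  define V where "V = (\<Union>\<tau>\<in>S-{\<sigma>}. open_image \<tau>)"
  have "open V" unfolding V_def using edge_open by auto
  moreover have "open_image \<sigma> \<inter> V = {}" unfolding V_def using edge_disjoint[OF \<open>\<sigma> \<in> S\<close>] by blast
  moreover have "I \<subseteq> open_image \<sigma> \<union> V" using I unfolding V_def by blast
  ultimately have "V \<inter> I = {}"
    using connectedD[OF \<open>topological_space_class.connected I\<close>, of "open_image \<sigma>" V] edge_open[OF \<open>\<sigma> \<in> S\<close>] \<sigma> mem by blast
  then have "I \<subseteq> open_image \<sigma>" using \<open>I \<subseteq> open_image \<sigma> \<union> V\<close> by blast
  then show ?thesis using that \<sigma> \<epsilon> unfolding I_def by blast
qed

end

text \<open>
  In the coordinate of \<open>\<sigma>\<close> both arcs sweep out an interval with left end \<open>0\<close>; two such intervals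
  overlap.
\<close>

lemma arcs_entering_same_start_meet:
  fixes \<sigma> :: "real \<Rightarrow> 'a::metric_space"
  assumes \<sigma>: "Path_Connected.arc \<sigma>"
    and \<gamma>: "Path_Connected.arc \<gamma>" "pathstart \<gamma> = pathstart \<sigma>"
      "0 < \<epsilon>" "\<epsilon> < 1" "\<gamma> ` {0<..\<epsilon>} \<subseteq> open_image \<sigma>"
    and \<delta>: "Path_Connected.arc \<delta>" "pathstart \<delta> = pathstart \<sigma>"
      "0 < \<epsilon>'" "\<epsilon>' < 1" "\<delta> ` {0<..\<epsilon>'} \<subseteq> open_image \<sigma>"
  shows "open_image \<gamma> \<inter> open_image \<delta> \<noteq> {}"
proof -
  obtain h where h: "homeomorphism {0..1} (path_image \<sigma>) \<sigma> h"
    using homeomorphism_arc[OF \<sigma>] .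
  have sweep: "\<exists>x>0. x \<le> 1 \<and> (\<forall>y\<in>{0<..x}. \<exists>t\<in>{0<..<1}. \<rho> t = \<sigma> y)"
    if \<rho>: "Path_Connected.arc \<rho>" "pathstart \<rho> = pathstart \<sigma>" "0 < e" "e < 1"
      "\<rho> ` {0<..e} \<subseteq> open_image \<sigma>" for \<rho> e
  proof -
    have \<rho>0: "\<rho> 0 = \<sigma> 0" using \<rho> by (simp add: pathstart_def)
    have im: "\<rho> ` {0..e} \<subseteq> path_image \<sigma>"
    proof
      fix y assume "y \<in> \<rho> ` {0..e}"
      then obtain t where "y = \<rho> t" "t = 0 \<or> t \<in> {0<..e}" by force
      then have "y = pathstart \<sigma> \<or> y \<in> open_image \<sigma>"
        using \<rho>(2,5) by (auto simp only: pathstart_def)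
      then show "y \<in> path_image \<sigma>" by (simp only: path_image_eq_open_image) blast
    qed
    have "continuous_on {0..e} \<rho>"
      using \<rho> by (auto simp: Path_Connected.arc_def path_def intro: continuous_on_subset)
    moreover have "continuous_on (\<rho> ` {0..e}) h"
      using h im by (auto simp: homeomorphism_def intro: continuous_on_subset)
    ultimately have cont: "continuous_on {0..e} (h \<circ> \<rho>)" by (rule continuous_on_compose)
    have h0: "(h \<circ> \<rho>) 0 = 0" using h \<rho>0 by (simp add: homeomorphism_def)
    have "\<rho> e \<in> open_image \<sigma>" using \<rho> by auto
    then obtain x where x: "0 < x" "x < 1" "\<rho> e = \<sigma> x" by auto
    then have hx: "(h \<circ> \<rho>) e = x" using h by (simp add: homeomorphism_def)
    have "\<exists>t\<in>{0<..<1}. \<rho> t = \<sigma> y" if y: "y \<in> {0<..x}" for y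
    proof -
      obtain t where t: "0 \<le> t" "t \<le> e" "(h \<circ> \<rho>) t = y"
        using IVT'[of "h \<circ> \<rho>" 0 y e] cont h0 hx y \<rho> by auto
      moreover have "t \<noteq> 0" using t h0 y by auto
      moreover have "\<rho> t = \<sigma> y"
        using t im h by (force simp: homeomorphism_def)
      ultimately show ?thesis using \<rho> by (intro bexI[of _ t]) auto
    qed
    then show ?thesis using x by (intro exI[of _ x]) auto
  qed
  obtain x where x: "x > 0" "\<forall>y\<in>{0<..x}. \<exists>t\<in>{0<..<1}. \<gamma> t = \<sigma> y"
    using sweep[OF \<gamma>] by auto
  obtain x' where x': "x' > 0" "\<forall>y\<in>{0<..x'}. \<exists>t\<in>{0<..<1}. \<delta> t = \<sigma> y"
    using sweep[OF \<delta>] by auto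
  have "min x x' \<in> {0<..x}" "min x x' \<in> {0<..x'}" using x x' by auto
  with x x' obtain t t' where "t \<in> {0<..<1}" "t' \<in> {0<..<1}" "\<gamma> t = \<sigma> (min x x')" "\<delta> t' = \<sigma> (min x x')"
    by metis
  then have "\<sigma> (min x x') \<in> open_image \<gamma>" "\<sigma> (min x x') \<in> open_image \<delta>" by (metis imageI)+
  then show ?thesis by blast
qed

lemma arcs_entering_same_end_meet:
  fixes \<sigma> :: "real \<Rightarrow> 'a::metric_space"
  assumes \<sigma>: "Path_Connected.arc \<sigma>" "v \<in> {pathstart \<sigma>, pathfinish \<sigma>}"
    and "Path_Connected.arc \<gamma>" "pathstart \<gamma> = v"
      "0 < \<epsilon>" "\<epsilon> < 1" "\<gamma> ` {0<..\<epsilon>} \<subseteq> open_image \<sigma>"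
    and "Path_Connected.arc \<delta>" "pathstart \<delta> = v"
      "0 < \<epsilon>'" "\<epsilon>' < 1" "\<delta> ` {0<..\<epsilon>'} \<subseteq> open_image \<sigma>"
  shows "open_image \<gamma> \<inter> open_image \<delta> \<noteq> {}"
proof (cases "v = pathstart \<sigma>")
  case True
  then show ?thesis using assms by (intro arcs_entering_same_start_meet[of \<sigma> \<gamma> \<epsilon> \<delta> \<epsilon>']) auto
next
  case False
  then have "v = pathstart (reversepath \<sigma>)" using \<sigma> by auto
  then show ?thesis
    using assms arc_reversepath[of \<sigma>]
    by (intro arcs_entering_same_start_meet[of "reversepath \<sigma>" \<gamma> \<epsilon> \<delta> \<epsilon>']) simp_all
qed

section \<open>Computing out-degrees\<close>

definition escaping :: "'a::metric_space set \<Rightarrow> 'a \<Rightarrow> (real \<Rightarrow> 'a) set \<Rightarrow> bool" where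
  "escaping A v F \<longleftrightarrow> finite F \<and>
     (\<forall>\<gamma>\<in>F. Path_Connected.arc \<gamma> \<and> pathstart \<gamma> = v \<and> \<gamma> ` {0<..1} \<subseteq> - A) \<and>
     disjoint_family_on open_image F"

lemma outdeg_eq_Max: "outdeg A v = Max {card F |F. escaping A v F}"
  by (simp add: outdeg_def escaping_def)

context arc_decomposition
begin

text \<open>
  Arcs of an escaping family leave \<open>v\<close> along different edges, since two that enter the same edge
  would meet; and the edge that an arc enters contains points of that arc, which lie outside \<open>A\<close>.
\<close>

lemma card_escaping_le:
  assumes v: "v \<in> W" and F: "escaping A v F"
  shows "card F \<le> card {\<sigma>\<in>S. v \<in> {pathstart \<sigma>, pathfinish \<sigma>} \<and> \<not> path_image \<sigma> \<subseteq> A}"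
proof -
  have "\<exists>\<sigma> \<epsilon>. \<sigma> \<in> S \<and> v \<in> {pathstart \<sigma>, pathfinish \<sigma>} \<and> 0 < \<epsilon> \<and> \<epsilon> < 1 \<and> \<gamma> ` {0<..\<epsilon>} \<subseteq> open_image \<sigma>"
    if "\<gamma> \<in> F" for \<gamma>
  proof -
    have "Path_Connected.arc \<gamma>" "pathstart \<gamma> = v" using F that by (auto simp: escaping_def)
    from arc_enters_edge[OF v this] show ?thesis by metis
  qed
  then obtain s e where s: "\<And>\<gamma>. \<gamma> \<in> F \<Longrightarrow> s \<gamma> \<in> S \<and> v \<in> {pathstart (s \<gamma>), pathfinish (s \<gamma>)} \<and>
      0 < e \<gamma> \<and> e \<gamma> < 1 \<and> \<gamma> ` {0<..e \<gamma>} \<subseteq> open_image (s \<gamma>)"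
    by metis
  have "inj_on s F"
  proof (rule inj_onI, rule ccontr)
    fix \<gamma> \<delta> assume *: "\<gamma> \<in> F" "\<delta> \<in> F" "s \<gamma> = s \<delta>" "\<gamma> \<noteq> \<delta>"
    have "open_image \<gamma> \<inter> open_image \<delta> \<noteq> {}"
      using * s[of \<gamma>] s[of \<delta>] F edge_arc[of "s \<gamma>"]
      by (intro arcs_entering_same_end_meet[of "s \<gamma>" v \<gamma> "e \<gamma>" \<delta> "e \<delta>"]) (auto simp: escaping_def)
    then show False using * F by (auto simp: escaping_def disjoint_family_on_def)
  qed
  moreover have "\<not> path_image (s \<gamma>) \<subseteq> A" if "\<gamma> \<in> F" for \<gamma>
  proof -
    have "e \<gamma> \<in> {0<..e \<gamma>}" using s[OF that] by simp
    then have "\<gamma> (e \<gamma>) \<in> open_image (s \<gamma>)" using s[OF that] by blast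
    then have "\<gamma> (e \<gamma>) \<in> path_image (s \<gamma>)" by (simp only: path_image_eq_open_image) blast
    moreover have "\<gamma> (e \<gamma>) \<notin> A" using s[OF that] F that by (force simp: escaping_def)
    ultimately show ?thesis by blast
  qed
  ultimately show ?thesis
    using s finite_edges by (intro card_inj_on_le[of s]) auto
qed

lemma outdeg_le:
  assumes "v \<in> W"
  shows "outdeg A v \<le> card {\<sigma>\<in>S. v \<in> {pathstart \<sigma>, pathfinish \<sigma>} \<and> \<not> path_image \<sigma> \<subseteq> A}"
    (is "_ \<le> ?n")
proof -
  have bound: "{card F |F. escaping A v F} \<subseteq> {..?n}" using card_escaping_le[OF assms] by auto
  have "escaping A v {}" by (simp add: escaping_def disjoint_family_on_def)
  then have "{card F |F. escaping A v F} \<noteq> {}" by blast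
  then show ?thesis
    unfolding outdeg_eq_Max using bound finite_subset[OF bound] by (intro Max.boundedI) auto
qed

text \<open>
  A new node on an edge splits it in two, so subdivision keeps the Euler characteristic.
\<close>

lemma refine_at_point:
  "\<exists>W' S'. arc_decomposition W' S' \<and> insert x W \<subseteq> W' \<and> card S' + card W = card S + card W'"
proof (cases "x \<in> W")
  case True
  then show ?thesis using arc_decomposition_axioms by (intro exI[of _ W] exI[of _ S]) auto
next
  case False
  then obtain \<sigma> where \<sigma>: "\<sigma> \<in> S" "x \<in> open_image \<sigma>" by (metis point_cases)
  then obtain u where u: "0 < u" "u < 1" "x = \<sigma> u" by auto
  let ?l = "subarc 0 u \<sigma>" and ?r = "subarc u 1 \<sigma>"
  have cont: "continuous_on {0..1} \<sigma>" and inj: "inj_on \<sigma> {0..1}"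
    using edge_arc[OF \<sigma>(1)] by (auto simp: Path_Connected.arc_def path_def)
  have oi: "open_image ?l = \<sigma> ` {0<..<u}" "open_image ?r = \<sigma> ` {u<..<1}"
    using u by (auto simp: open_image_subarc)
  have pi: "path_image ?l = \<sigma> ` {0..u}" "path_image ?r = \<sigma> ` {u..1}"
    using u by (auto simp: path_image_subarc)
  have arcs: "Path_Connected.arc ?l" "Path_Connected.arc ?r"
    using u by (auto intro!: arc_subarc continuous_on_subset[OF cont] inj_on_subset[OF inj])
  have closed: "closed (\<sigma> ` {0..u})" "closed (\<sigma> ` {u..1})"
    using u by (auto intro!: compact_imp_closed compact_continuous_image continuous_on_subset[OF cont])
  have "\<sigma> ` {0<..<u} = open_image \<sigma> - \<sigma> ` {u..1}" "\<sigma> ` {u<..<1} = open_image \<sigma> - \<sigma> ` {0..u}"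
    using u inj unfolding inj_on_def by force+
  then have opens: "open (open_image ?l)" "open (open_image ?r)"
    unfolding oi using edge_open[OF \<sigma>(1)] closed by (simp_all add: open_Diff)
  have sub: "open_image ?l \<subseteq> open_image \<sigma>" "open_image ?r \<subseteq> open_image \<sigma>" unfolding oi using u by auto
  have x_notin: "x \<notin> open_image ?l" "x \<notin> open_image ?r" unfolding oi u(3) using u inj
    unfolding inj_on_def by force+
  have disj: "open_image ?l \<inter> open_image ?r = {}"
    unfolding oi using u inj unfolding inj_on_def by force
  have ne: "open_image \<tau> \<noteq> {}" for \<tau> :: "real \<Rightarrow> 'a" by auto
  have "?l \<noteq> ?r" using disj ne[of ?l] by auto
  have out: "open_image \<tau> \<inter> open_image \<sigma> = {}" if "\<tau> \<in> S - {\<sigma>}" for \<tau>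
    using edge_disjoint[of \<tau> \<sigma>] that \<sigma> by blast
  have new: "?l \<notin> S - {\<sigma>}" "?r \<notin> S - {\<sigma>}"
    using out[of ?l] out[of ?r] sub ne[of ?l] ne[of ?r] by blast+
  define S' where "S' = insert ?l (insert ?r (S - {\<sigma>}))"
  have \<sigma>im: "path_image \<sigma> = path_image ?l \<union> path_image ?r"
    unfolding pi unfolding path_image_def image_Un[symmetric] using u by (simp add: ivl_disj_un_two_touch)
  have "card S' = Suc (Suc (card (S - {\<sigma>})))"
    unfolding S'_def using finite_edges \<open>?l \<noteq> ?r\<close> new by simp
  moreover have "card S = Suc (card (S - {\<sigma>}))" by (rule card.remove[OF finite_edges \<sigma>(1)])
  ultimately have "card S' + card W = card S + card (insert x W)"
    using finite_nodes False by simp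
  moreover have "arc_decomposition (insert x W) S'"
  proof
    show "finite (insert x W)" "finite S'" using finite_nodes finite_edges by (auto simp: S'_def)
    show "Path_Connected.arc \<tau>" if "\<tau> \<in> S'" for \<tau> using that arcs edge_arc by (auto simp: S'_def)
    show "pathstart \<tau> \<in> insert x W" if "\<tau> \<in> S'" for \<tau>
      using that edge_start edge_start[OF \<sigma>(1)] u by (auto simp: S'_def pathstart_def[of \<sigma>])
    show "pathfinish \<tau> \<in> insert x W" if "\<tau> \<in> S'" for \<tau>
      using that edge_finish edge_finish[OF \<sigma>(1)] u by (auto simp: S'_def pathfinish_def[of \<sigma>])
    show "open (open_image \<tau>)" if "\<tau> \<in> S'" for \<tau> using that opens edge_open by (auto simp: S'_def)
    show "open_image \<tau> \<inter> insert x W = {}" if \<tau>: "\<tau> \<in> S'" for \<tau>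
    proof -
      consider "\<tau> = ?l" | "\<tau> = ?r" | "\<tau> \<in> S - {\<sigma>}" using \<tau> by (auto simp: S'_def)
      then show ?thesis
      proof cases
        case 1 then show ?thesis using x_notin sub edge_avoids_nodes[OF \<sigma>(1)] by blast
      next
        case 2 then show ?thesis using x_notin sub edge_avoids_nodes[OF \<sigma>(1)] by blast
      next
        case 3 then show ?thesis using out[of \<tau>] \<sigma>(2) edge_avoids_nodes[of \<tau>] by blast
      qed
    qed
    have l: "open_image ?l \<inter> open_image \<tau> = {}" and r: "open_image ?r \<inter> open_image \<tau> = {}"
      if "\<tau> \<in> S - {\<sigma>}" for \<tau> using out[OF that] sub by blast+
    show "open_image \<tau> \<inter> open_image \<rho> = {}" if \<tau>\<rho>: "\<tau> \<in> S'" "\<rho> \<in> S'" "\<tau> \<noteq> \<rho>" for \<tau> \<rho>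
    proof -
      consider "\<tau> = ?l" | "\<tau> = ?r" | "\<tau> \<in> S - {\<sigma>}" using \<tau>\<rho> by (auto simp: S'_def)
      moreover consider "\<rho> = ?l" | "\<rho> = ?r" | "\<rho> \<in> S - {\<sigma>}" using \<tau>\<rho> by (auto simp: S'_def)
      ultimately show ?thesis
        using \<tau>\<rho>(3) disj l r edge_disjoint[of \<tau> \<rho>] by (metis Diff_iff inf_commute)
    qed
    have "(\<Union>\<tau>\<in>S. path_image \<tau>) \<subseteq> (\<Union>\<tau>\<in>S'. path_image \<tau>)"
    proof (rule UN_least)
      fix \<tau> assume "\<tau> \<in> S"
      then show "path_image \<tau> \<subseteq> (\<Union>\<tau>\<in>S'. path_image \<tau>)"
        using \<sigma>im by (cases "\<tau> = \<sigma>") (auto simp: S'_def)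
    qed
    then show "insert x W \<union> (\<Union>\<tau>\<in>S'. path_image \<tau>) = UNIV" using cover by blast
  qed
  ultimately show ?thesis by blast
qed

text \<open>
  Subdividing at the start \<open>v\<close> makes the previous bound available at an arbitrary point, so that the
  maximum in \<open>outdeg\<close> is attained and dominates every escaping family.
\<close>

lemma outdeg_ge:
  fixes A :: "'a set"
  assumes "escaping A v F"
  shows "card F \<le> outdeg A v"
proof -
  obtain W' S' where dec: "arc_decomposition W' S'" and v: "v \<in> W'"
    using refine_at_point[of v] by auto
  interpret D: arc_decomposition W' S' by fact
  have "{card F |F. escaping A v F} \<subseteq> {..card {\<sigma>\<in>S'. v \<in> {pathstart \<sigma>, pathfinish \<sigma>} \<and> \<not> path_image \<sigma> \<subseteq> A}}"
    using D.card_escaping_le[OF v] by auto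
  then have "finite {card F |F. escaping A v F}" by (rule finite_subset) simp
  then show ?thesis unfolding outdeg_eq_Max using assms by (intro Max_ge) auto
qed

end

lemma refine_at_finite_set:
  assumes "finite X" "arc_decomposition W S"
  shows "\<exists>W' S'. arc_decomposition W' S' \<and> X \<union> W \<subseteq> W' \<and> card S' + card W = card S + card W'"
  using assms(1)
proof induction
  case empty
  then show ?case using assms(2) by auto
next
  case (insert x X)
  then obtain W' S' where *: "arc_decomposition W' S'" "X \<union> W \<subseteq> W'" "card S' + card W = card S + card W'"
    by auto
  obtain W'' S'' where "arc_decomposition W'' S''" "insert x W' \<subseteq> W''"
      "card S'' + card W' = card S' + card W''"
    using arc_decomposition.refine_at_point[OF *(1)] by blast
  then show ?case using * by (intro exI[of _ W''] exI[of _ S'']) auto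
qed

lemma escaping_start_in_frontier:
  assumes F: "escaping A v F" "F \<noteq> {}" and v: "v \<in> A"
  shows "v \<in> frontier A"
proof -
  obtain \<gamma> where \<gamma>: "Path_Connected.arc \<gamma>" "\<gamma> 0 = v" "\<gamma> ` {0<..1} \<subseteq> - A"
    using F by (auto simp: escaping_def pathstart_def)
  have "continuous_on (closure {0<..1}) \<gamma>"
    using \<gamma> by (simp add: Path_Connected.arc_def path_def)
  then have "\<gamma> ` closure {0<..1} \<subseteq> closure (- A)"
    using \<gamma>(3) by (intro image_closure_subset) (auto intro: closure_subset[THEN subsetD])
  then have "v \<in> closure (- A)" using \<gamma>(2) by auto
  then show ?thesis using v closure_subset[of A] by (auto simp: frontier_closures)
qed

section \<open>Burning\<close>

context arc_decomposition
begin

definition edges_to :: "'a \<Rightarrow> 'a set \<Rightarrow> (real \<Rightarrow> 'a) set" where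
  "edges_to v B = {\<sigma>\<in>S. pathstart \<sigma> = v \<and> pathfinish \<sigma> \<in> B \<or> pathfinish \<sigma> = v \<and> pathstart \<sigma> \<in> B}"

definition edges_within :: "'a set \<Rightarrow> (real \<Rightarrow> 'a) set" where
  "edges_within B = {\<sigma>\<in>S. pathstart \<sigma> \<in> B \<and> pathfinish \<sigma> \<in> B}"

text \<open>
  Dhar's burning algorithm: a fire lit at \<open>v\<^sub>0\<close> consumes a node as soon as more burning edges reach
  it than it has chips.
\<close>

inductive burnt :: "'a \<Rightarrow> ('a \<Rightarrow> int) \<Rightarrow> 'a set \<Rightarrow> bool" for v\<^sub>0 d where
  ignite: "burnt v\<^sub>0 d {v\<^sub>0}"
| spread: "burnt v\<^sub>0 d B \<Longrightarrow> v \<in> W \<Longrightarrow> v \<notin> B \<Longrightarrow> d v < int (card (edges_to v B)) \<Longrightarrow>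
    burnt v\<^sub>0 d (insert v B)"

lemma finite_edges_to [simp]: "finite (edges_to v B)"
  using finite_edges by (simp add: edges_to_def)

lemma finite_edges_within [simp]: "finite (edges_within B)"
  using finite_edges by (simp add: edges_within_def)

lemma edges_within_insert: "edges_within (insert v B) = edges_within B \<union> edges_to v B"
  using ends_distinct by (auto simp: edges_within_def edges_to_def)

lemma card_edges_within_insert:
  assumes "v \<notin> B"
  shows "card (edges_within (insert v B)) = card (edges_within B) + card (edges_to v B)"
proof -
  have "edges_within B \<inter> edges_to v B = {}"
    using assms by (auto simp: edges_within_def edges_to_def)
  then show ?thesis by (simp add: edges_within_insert card_Un_disjoint)
qed

lemma burnt_finite: "burnt v\<^sub>0 d B \<Longrightarrow> finite B \<and> v\<^sub>0 \<in> B"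
  by (induction rule: burnt.induct) auto

lemma burnt_subset: "burnt v\<^sub>0 d B \<Longrightarrow> v\<^sub>0 \<in> W \<Longrightarrow> B \<subseteq> W"
  by (induction rule: burnt.induct) auto

lemma burnt_cong: "burnt v\<^sub>0 d B \<Longrightarrow> (\<And>v. v \<in> B \<Longrightarrow> d v = d' v) \<Longrightarrow> burnt v\<^sub>0 d' B"
proof (induction rule: burnt.induct)
  case ignite
  then show ?case by (simp add: burnt.ignite)
next
  case (spread B v)
  then have "burnt v\<^sub>0 d' B" "d' v < int (card (edges_to v B))" by auto
  then show ?case using spread.hyps by (simp add: burnt.spread)
qed

text \<open>
  Each node consumes at least one more incoming burning edge than its chips; summing over the
  order of burning, if it were always exactly one more, the edges would be as many as the chips and
  the nodes other than \<open>v\<^sub>0\<close> together.  So with more edges some node burns with an edge to spare, and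
  that node can take another chip without delaying the fire.
\<close>

lemma burnt_add_chip:
  assumes "burnt v\<^sub>0 d B" "sum d (B - {v\<^sub>0}) + int (card B) - 1 < int (card (edges_within B))"
  shows "\<exists>w\<in>B - {v\<^sub>0}. burnt v\<^sub>0 (d(w := d w + 1)) B"
  using assms
proof (induction rule: burnt.induct)
  case ignite
  have "edges_within {v\<^sub>0} = {}" using ends_distinct by (auto simp: edges_within_def)
  then show ?case using ignite by simp
next
  case (spread B v)
  have fin: "finite B" "v\<^sub>0 \<in> B" using burnt_finite[OF spread.hyps(1)] by auto
  then have "v \<noteq> v\<^sub>0" using spread by auto
  show ?case
  proof (cases "d v + 1 < int (card (edges_to v B))")
    case True
    have "burnt v\<^sub>0 (d(v := d v + 1)) B"
      using spread.hyps(1) by (rule burnt_cong) (use spread.hyps in auto)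
    then have "burnt v\<^sub>0 (d(v := d v + 1)) (insert v B)"
      using spread.hyps True by (intro burnt.spread) auto
    then show ?thesis using \<open>v \<noteq> v\<^sub>0\<close> by blast
  next
    case False
    have "insert v B - {v\<^sub>0} = insert v (B - {v\<^sub>0})" using \<open>v \<noteq> v\<^sub>0\<close> by auto
    then have "sum d (insert v B - {v\<^sub>0}) = d v + sum d (B - {v\<^sub>0})"
      using fin spread.hyps by simp
    then have "sum d (B - {v\<^sub>0}) + int (card B) - 1 < int (card (edges_within B))"
      using spread.prems False fin spread.hyps by (simp add: card_edges_within_insert)
    then obtain w where w: "w \<in> B - {v\<^sub>0}" "burnt v\<^sub>0 (d(w := d w + 1)) B"
      using spread.IH by blast
    then have "burnt v\<^sub>0 (d(w := d w + 1)) (insert v B)"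
      using spread.hyps by (intro burnt.spread) auto
    then show ?thesis using w by blast
  qed
qed

text \<open>
  If the fire stops at \<open>B\<close>, then the full subgraph on the other nodes is a closed set all of whose
  boundary points are saturated.
\<close>

lemma reduced_imp_burnt:
  assumes v0: "v\<^sub>0 \<in> W" and red: "v0_reduced v\<^sub>0 D"
  shows "burnt v\<^sub>0 (Poly_Mapping.lookup D) W"
proof -
  let ?d = "Poly_Mapping.lookup D"
  have "{B. burnt v\<^sub>0 ?d B} \<subseteq> Pow W" using burnt_subset v0 by auto
  then have "finite {B. burnt v\<^sub>0 ?d B}" using finite_nodes finite_subset by auto
  moreover have "{B. burnt v\<^sub>0 ?d B} \<noteq> {}" using burnt.ignite by blast
  ultimately obtain B where B: "burnt v\<^sub>0 ?d B" "\<And>B'. burnt v\<^sub>0 ?d B' \<Longrightarrow> B \<subseteq> B' \<Longrightarrow> B' = B"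
    using finite_has_maximal[of "{B. burnt v\<^sub>0 ?d B}"] by (metis mem_Collect_eq)
  have sub: "B \<subseteq> W" "v\<^sub>0 \<in> B" using burnt_subset[OF B(1) v0] burnt_finite[OF B(1)] by auto
  have "B = W"
  proof (rule ccontr)
    assume "B \<noteq> W"
    define A where "A = (W - B) \<union> (\<Union>\<sigma>\<in>edges_within (W - B). path_image \<sigma>)"
    have "compact A"
      unfolding A_def using finite_nodes finite_edges_within edge_arc
      by (intro compact_Un compact_UN)
        (auto intro!: finite_imp_compact compact_path_image arc_imp_path simp: edges_within_def
          simp del: finite_edges_within intro: finite_subset[OF _ finite_edges])
    moreover have "A \<noteq> {}" using \<open>B \<noteq> W\<close> sub by (auto simp: A_def)
    moreover have AW: "A \<inter> W = W - B"
      using edge_avoids_nodes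
      by (auto simp: A_def edges_within_def path_image_eq_open_image)
    moreover have "A \<subseteq> - {v\<^sub>0}" using AW v0 sub by auto
    ultimately obtain v where v: "v \<in> frontier A" "\<not> saturated D A v"
      using red unfolding v0_reduced_def by blast
    have "v \<in> A" using v \<open>compact A\<close> by (meson compact_imp_closed frontier_subset_closed subsetD)
    have "v \<in> W - B"
    proof (rule ccontr)
      assume "v \<notin> W - B"
      then obtain \<sigma> where \<sigma>: "\<sigma> \<in> edges_within (W - B)" "v \<in> open_image \<sigma>"
        using \<open>v \<in> A\<close> by (auto simp: A_def edges_within_def path_image_eq_open_image)
      then have "open_image \<sigma> \<subseteq> A" by (auto simp: A_def path_image_eq_open_image)
      moreover have "open (open_image \<sigma>)" using \<sigma> edge_open by (auto simp: edges_within_def)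
      ultimately have "v \<in> interior A" using \<sigma> by (meson interiorI)
      then show False using v by (simp add: frontier_def)
    qed
    then have "v \<in> W" "v \<notin> B" by auto
    have "{\<sigma>\<in>S. v \<in> {pathstart \<sigma>, pathfinish \<sigma>} \<and> \<not> path_image \<sigma> \<subseteq> A} \<subseteq> edges_to v B"
    proof
      fix \<sigma> assume "\<sigma> \<in> {\<sigma>\<in>S. v \<in> {pathstart \<sigma>, pathfinish \<sigma>} \<and> \<not> path_image \<sigma> \<subseteq> A}"
      then have \<sigma>: "\<sigma> \<in> S" "v \<in> {pathstart \<sigma>, pathfinish \<sigma>}" "\<not> path_image \<sigma> \<subseteq> A" by auto
      then have "\<sigma> \<notin> edges_within (W - B)" by (auto simp: A_def)
      then show "\<sigma> \<in> edges_to v B"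
        using \<sigma> \<open>v \<notin> B\<close> edge_start[OF \<sigma>(1)] edge_finish[OF \<sigma>(1)]
        by (auto simp: edges_within_def edges_to_def)
    qed
    then have "outdeg A v \<le> card (edges_to v B)"
      using outdeg_le[OF \<open>v \<in> W\<close>, of A] card_mono[OF finite_edges_to] le_trans by blast
    then have "?d v < int (card (edges_to v B))" using v by (simp add: saturated_def)
    then have "burnt v\<^sub>0 ?d (insert v B)"
      using B \<open>v \<in> W\<close> \<open>v \<notin> B\<close> by (intro burnt.spread) auto
    then show False using B(2)[of "insert v B"] \<open>v \<notin> B\<close> by auto
  qed
  then show ?thesis using B by simp
qed

lemma burnt_first_node_in:
  assumes "burnt v\<^sub>0 d B" "v\<^sub>0 \<notin> A" "A \<inter> B \<noteq> {}"
  shows "\<exists>v\<in>A \<inter> W. \<exists>B'. B' \<inter> A = {} \<and> d v < int (card (edges_to v B'))"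
  using assms
proof (induction rule: burnt.induct)
  case ignite
  then show ?case by auto
next
  case (spread B v)
  then show ?case by (cases "A \<inter> B = {}") blast+
qed

text \<open>
  At the first point of \<open>A\<close> along \<open>\<rho>\<close>, the part of \<open>\<rho>\<close> already travelled, run backwards, is an arc that
  escapes from \<open>A\<close>.
\<close>

lemma outdeg_first_hit:
  fixes A :: "'a set"
  assumes \<rho>: "Path_Connected.arc \<rho>" "pathstart \<rho> \<notin> A" and A: "closed A"
    and hit: "x \<in> open_image \<rho>" "x \<in> A"
  shows "\<exists>y\<in>open_image \<rho> \<inter> frontier A. 1 \<le> outdeg A y"
proof -
  have cont: "continuous_on {0..1} \<rho>" and inj: "inj_on \<rho> {0..1}"
    using \<rho> by (auto simp: Path_Connected.arc_def path_def)
  obtain u where u: "0 < u" "u < 1" "x = \<rho> u" using hit by auto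
  define T where "T = {0..u} \<inter> \<rho> -` A"
  have "closed T"
    unfolding T_def using A u
    by (intro continuous_closed_preimage continuous_on_subset[OF cont]) auto
  then have "compact T" by (simp add: compact_eq_bounded_closed T_def bounded_Int)
  moreover have "u \<in> T" using u hit by (auto simp: T_def)
  ultimately obtain t where t: "t \<in> T" "\<And>s. s \<in> T \<Longrightarrow> t \<le> s"
    using compact_attains_inf[of T] by blast
  have "t \<noteq> 0" using t \<rho> by (auto simp: T_def pathstart_def)
  then have t01: "0 < t" "t < 1" "\<rho> t \<in> A" using t u by (auto simp: T_def)
  have before: "\<rho> s \<notin> A" if "0 \<le> s" "s < t" for s
    using t(1) t(2)[of s] that by (auto simp: T_def)
  let ?\<gamma> = "reversepath (subarc 0 t \<rho>)"
  have "Path_Connected.arc (subarc 0 t \<rho>)"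
    using t01 by (intro arc_subarc) (auto intro: continuous_on_subset[OF cont] inj_on_subset[OF inj])
  then have "Path_Connected.arc ?\<gamma>" by (rule arc_reversepath)
  moreover have "?\<gamma> s \<notin> A" if "0 < s" "s \<le> 1" for s
  proof -
    have "t * (1 - s) < t * 1" "0 \<le> t * (1 - s)"
      using that t01 by (intro mult_strict_left_mono mult_nonneg_nonneg; simp)+
    then show ?thesis using before[of "t * (1 - s)"] by (simp add: reversepath_def subarc_def)
  qed
  ultimately have "escaping A (\<rho> t) {?\<gamma>}"
    by (auto simp: escaping_def disjoint_family_on_def)
  then have "1 \<le> outdeg A (\<rho> t)" "\<rho> t \<in> frontier A"
    using outdeg_ge escaping_start_in_frontier t01(3) by fastforce+
  then show ?thesis using t01 by auto
qed

lemma outdeg_within_edge: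
  assumes \<sigma>: "\<sigma> \<in> S" "pathstart \<sigma> \<notin> A \<or> pathfinish \<sigma> \<notin> A" and A: "closed A"
    and hit: "open_image \<sigma> \<inter> A \<noteq> {}"
  shows "\<exists>y\<in>open_image \<sigma> \<inter> frontier A. 1 \<le> outdeg A y"
proof (cases "pathstart \<sigma> \<notin> A")
  case True
  then show ?thesis using outdeg_first_hit[of \<sigma> A] edge_arc assms by blast
next
  case False
  then have "pathstart (reversepath \<sigma>) \<notin> A" using \<sigma> by auto
  then show ?thesis
    using outdeg_first_hit[of "reversepath \<sigma>" A] arc_reversepath edge_arc[OF \<sigma>(1)] A hit
    unfolding open_image_reversepath by blast
qed

lemma outdeg_ge_card_edges_to:
  assumes v: "v \<in> A" and B: "B \<inter> A = {}"
    and free: "\<And>\<sigma>. \<sigma> \<in> edges_to v B \<Longrightarrow> open_image \<sigma> \<inter> A = {}"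
    and ne: "edges_to v B \<noteq> {}"
  shows "card (edges_to v B) \<le> outdeg A v" "v \<in> frontier A"
proof -
  \<comment> \<open>Every edge from \<open>B\<close> to \<open>v\<close>, directed away from \<open>v\<close>, is an escaping arc.\<close>
  define orient where "orient \<sigma> = (if pathstart \<sigma> = v then \<sigma> else reversepath \<sigma>)" for \<sigma> :: "real \<Rightarrow> 'a"
  have oi: "open_image (orient \<sigma>) = open_image \<sigma>" for \<sigma> by (simp add: orient_def)
  have neq: "open_image (orient \<sigma>) \<inter> open_image (orient \<tau>) = {}"
    if "\<sigma> \<in> edges_to v B" "\<tau> \<in> edges_to v B" "\<sigma> \<noteq> \<tau>" for \<sigma> \<tau>
    unfolding oi using that edge_disjoint by (auto simp: edges_to_def)
  have inj: "inj_on orient (edges_to v B)"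
  proof (rule inj_onI, rule ccontr)
    fix \<sigma> \<tau> assume "\<sigma> \<in> edges_to v B" "\<tau> \<in> edges_to v B" "orient \<sigma> = orient \<tau>" "\<sigma> \<noteq> \<tau>"
    then show False using neq[of \<sigma> \<tau>] by auto
  qed
  have "Path_Connected.arc (orient \<sigma>) \<and> pathstart (orient \<sigma>) = v \<and> orient \<sigma> ` {0<..1} \<subseteq> - A"
    if \<sigma>: "\<sigma> \<in> edges_to v B" for \<sigma>
  proof (intro conjI)
    have "v \<notin> B" using v B by auto
    show "Path_Connected.arc (orient \<sigma>)"
      using \<sigma> edge_arc arc_reversepath by (auto simp: orient_def edges_to_def)
    show "pathstart (orient \<sigma>) = v" using \<sigma> by (auto simp: orient_def edges_to_def)
    have "pathfinish (orient \<sigma>) \<in> B" using \<sigma> \<open>v \<notin> B\<close> by (auto simp: orient_def edges_to_def)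
    moreover have "orient \<sigma> ` {0<..1} = insert (pathfinish (orient \<sigma>)) (open_image (orient \<sigma>))"
    proof -
      have "{0<..1::real} = insert 1 {0<..<1}" by auto
      then show ?thesis by (simp only: pathfinish_def image_insert)
    qed
    ultimately show "orient \<sigma> ` {0<..1} \<subseteq> - A"
      using free[OF \<sigma>] B oi[of \<sigma>] by (simp add: disjoint_iff subset_iff)
  qed
  moreover have "disjoint_family_on open_image (orient ` edges_to v B)"
    unfolding disjoint_family_on_def
  proof (intro ballI impI)
    fix \<gamma> \<delta> assume "\<gamma> \<in> orient ` edges_to v B" "\<delta> \<in> orient ` edges_to v B" and "\<gamma> \<noteq> \<delta>"
    then obtain \<sigma> \<tau> where "\<sigma> \<in> edges_to v B" "\<tau> \<in> edges_to v B" "\<gamma> = orient \<sigma>" "\<delta> = orient \<tau>"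
      by (elim imageE)
    then show "open_image \<gamma> \<inter> open_image \<delta> = {}"
      using neq[of \<sigma> \<tau>] \<open>\<gamma> \<noteq> \<delta>\<close> by metis
  qed
  ultimately have esc: "escaping A v (orient ` edges_to v B)" by (auto simp: escaping_def)
  show "card (edges_to v B) \<le> outdeg A v" using outdeg_ge[OF esc] card_image[OF inj] by simp
  show "v \<in> frontier A" using escaping_start_in_frontier[OF esc] ne v by blast
qed

text \<open>
  Let \<open>v\<close> be the first node of \<open>A\<close> to burn.  Along each edge that brings it the fire, either \<open>A\<close>
  is met before \<open>v\<close>, at a chipless point that is not saturated, or the edge escapes from \<open>A\<close> at \<open>v\<close>;
  if all these edges escape, there are more of them than chips at \<open>v\<close>.
\<close>

lemma burnt_imp_reduced:
  assumes v0: "v\<^sub>0 \<in> W" and supp: "Poly_Mapping.keys D \<subseteq> W"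
    and nonneg: "\<And>v. v \<noteq> v\<^sub>0 \<Longrightarrow> 0 \<le> Poly_Mapping.lookup D v"
    and burnt: "burnt v\<^sub>0 (Poly_Mapping.lookup D) W"
  shows "v0_reduced v\<^sub>0 D"
  unfolding v0_reduced_def
proof (intro conjI allI impI)
  fix A :: "'a set" assume A: "A \<noteq> {}" "compact A" "A \<subseteq> - {v\<^sub>0}"
  have "closed A" using A by (simp add: compact_imp_closed)
  have inside: "\<exists>v\<in>frontier A. \<not> saturated D A v"
    if \<sigma>: "\<sigma> \<in> S" "pathstart \<sigma> \<notin> A \<or> pathfinish \<sigma> \<notin> A" "open_image \<sigma> \<inter> A \<noteq> {}" for \<sigma>
  proof -
    obtain y where y: "y \<in> open_image \<sigma>" "y \<in> frontier A" "1 \<le> outdeg A y"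
      using outdeg_within_edge[OF \<sigma>(1,2) \<open>closed A\<close> \<sigma>(3)] by auto
    then have "Poly_Mapping.lookup D y = 0"
      using edge_avoids_nodes[OF \<sigma>(1)] supp by (meson disjoint_iff in_keys_iff subsetD)
    then show ?thesis using y by (intro bexI[of _ y]) (auto simp: saturated_def)
  qed
  show "\<exists>v\<in>frontier A. \<not> saturated D A v"
  proof (cases "A \<inter> W = {}")
    case True
    obtain x where "x \<in> A" using A by auto
    then obtain \<sigma> where "\<sigma> \<in> S" "x \<in> open_image \<sigma>" using True by (metis IntI empty_iff point_cases)
    then show ?thesis using inside[of \<sigma>] edge_start[of \<sigma>] True \<open>x \<in> A\<close> by blast
  next
    case False
    then obtain v B where v: "v \<in> A" "v \<in> W" "B \<inter> A = {}"
        "Poly_Mapping.lookup D v < int (card (edges_to v B))"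
      using burnt_first_node_in[OF burnt, of A] A by blast
    show ?thesis
    proof (cases "\<exists>\<sigma>\<in>edges_to v B. open_image \<sigma> \<inter> A \<noteq> {}")
      case True
      then obtain \<sigma> where "\<sigma> \<in> edges_to v B" "open_image \<sigma> \<inter> A \<noteq> {}" by auto
      then show ?thesis using v(3) by (intro inside[of \<sigma>]) (auto simp: edges_to_def)
    next
      case False
      have "v \<noteq> v\<^sub>0" using v A by auto
      then have "edges_to v B \<noteq> {}" using v(4) nonneg[of v] by auto
      then have "card (edges_to v B) \<le> outdeg A v" "v \<in> frontier A"
        using outdeg_ge_card_edges_to[OF v(1,3)] False by blast+
      then show ?thesis using v by (intro bexI[of _ v]) (auto simp: saturated_def)
    qed
  qed
qed (fact nonneg)

end

section \<open>The genus\<close>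

lemma lookup_scaleR_poly_mapping [simp]:
  "Poly_Mapping.lookup (r *\<^sub>R c) x = r *\<^sub>R Poly_Mapping.lookup c x"
proof -
  have "finite {i. r *\<^sub>R Poly_Mapping.lookup c i \<noteq> 0}"
    by (rule finite_subset[OF _ finite_keys[of c]]) (auto simp: in_keys_iff)
  then show ?thesis by (simp add: scaleR_poly_mapping_def)
qed

lemma lookup_boundary_map:
  assumes "finite E" "Poly_Mapping.keys c \<subseteq> E"
  shows "Poly_Mapping.lookup (boundary_map G c) v =
    (\<Sum>e\<in>E. Poly_Mapping.lookup c e * (of_bool (head G e = v) - of_bool (tail G e = v)))"
proof -
  have "Poly_Mapping.lookup (boundary_map G c) v = (\<Sum>e\<in>Poly_Mapping.keys c.
      Poly_Mapping.lookup c e * (of_bool (head G e = v) - of_bool (tail G e = v)))"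
    unfolding boundary_map_def
    by (simp add: lookup_sum lookup_minus lookup_single when_def of_bool_def if_distrib cong: if_cong)
  also have "\<dots> = (\<Sum>e\<in>E. Poly_Mapping.lookup c e * (of_bool (head G e = v) - of_bool (tail G e = v)))"
    using assms by (intro sum.mono_neutral_left) (auto simp: in_keys_iff)
  finally show ?thesis .
qed

context fin_digraph
begin

lemma connected_imp_crossing_arc:
  assumes "Digraph_Component.connected G" "B \<subseteq> verts G" "B \<noteq> {}" "B \<noteq> verts G"
  shows "\<exists>e\<in>arcs G. (tail G e \<in> B \<and> head G e \<in> verts G - B) \<or> (head G e \<in> B \<and> tail G e \<in> verts G - B)"
proof (rule ccontr)
  assume none: "\<not> ?thesis"
  obtain u v where uv: "u \<in> B" "v \<in> verts G" "v \<notin> B" using assms by auto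
  have "u \<rightarrow>\<^sup>*\<^bsub>with_proj (mk_symmetric G)\<^esub> v"
    using assms(1,2) uv unfolding Digraph_Component.connected_def strongly_connected_def by auto
  then have "v \<in> B"
    unfolding reachable_def
  proof (induction rule: rtrancl_on_induct)
    case base then show ?case using uv by simp
  next
    case (step x y)
    then have "(x, y) \<in> parcs (mk_symmetric G)" by simp
    then obtain e where "e \<in> arcs G" "(x, y) = (tail G e, head G e) \<or> (x, y) = (head G e, tail G e)"
      by (auto simp: mk_symmetric_def)
    then show ?case using none step.IH by auto
  qed
  then show False using uv by simp
qed

text \<open>
  Growing a tree one arc at a time.  The acyclicity of \<open>T\<close> is recorded in the form in which it is
  used: no nonzero cycle is supported in \<open>T\<close>.  It persists because the new arc is the only one that
  touches the new vertex, so that the boundary at that vertex kills its coefficient.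
\<close>

lemma spanning_tree_grows:
  assumes conn: "Digraph_Component.connected G" and n: "1 \<le> n" "n \<le> card (verts G)"
  shows "\<exists>B T. B \<subseteq> verts G \<and> card B = n \<and> T \<subseteq> arcs G \<and> Suc (card T) = n \<and>
    (\<forall>e\<in>T. tail G e \<in> B \<and> head G e \<in> B) \<and>
    (\<forall>c. Poly_Mapping.keys c \<subseteq> T \<longrightarrow> boundary_map G c = 0 \<longrightarrow> c = 0)"
  using n
proof (induction n rule: dec_induct)
  case base
  obtain u where "u \<in> verts G"
    using conn by (auto simp: Digraph_Component.connected_def strongly_connected_def)
  then show ?case by (intro exI[of _ "{u}"] exI[of _ "{}"]) auto
next
  case (step n)
  then obtain B T where IH: "B \<subseteq> verts G" "card B = n" "T \<subseteq> arcs G" "Suc (card T) = n"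
    "\<forall>e\<in>T. tail G e \<in> B \<and> head G e \<in> B"
    "\<And>c. Poly_Mapping.keys c \<subseteq> T \<Longrightarrow> boundary_map G c = 0 \<Longrightarrow> c = 0" by auto
  have fin: "finite B" "finite T" using IH by (auto intro: finite_subset[of _ "verts G"] finite_subset[of _ "arcs G"])
  have "B \<noteq> {}" "B \<noteq> verts G" using IH step by auto
  then obtain e v where e: "e \<in> arcs G" "v \<in> verts G - B"
      "(tail G e \<in> B \<and> head G e = v) \<or> (head G e \<in> B \<and> tail G e = v)"
    using connected_imp_crossing_arc[OF conn IH(1)] by metis
  have "e \<notin> T" using e IH(5) by auto
  have "c = 0" if c: "Poly_Mapping.keys c \<subseteq> insert e T" "boundary_map G c = 0" for c :: "'b \<Rightarrow>\<^sub>0 real"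
  proof -
    have "0 = (\<Sum>a\<in>insert e T. Poly_Mapping.lookup c a * (of_bool (head G a = v) - of_bool (tail G a = v)))"
      using lookup_boundary_map[of "insert e T" c G v] c fin by simp
    also have "\<dots> = Poly_Mapping.lookup c e * (of_bool (head G e = v) - of_bool (tail G e = v))
        + (\<Sum>a\<in>T. Poly_Mapping.lookup c a * (of_bool (head G a = v) - of_bool (tail G a = v)))"
      using fin \<open>e \<notin> T\<close> by simp
    also have "(\<Sum>a\<in>T. Poly_Mapping.lookup c a * (of_bool (head G a = v) - of_bool (tail G a = v))) = 0"
      using IH(5) e(2) by (intro sum.neutral) auto
    finally have "Poly_Mapping.lookup c e = 0" using e by auto
    then have "Poly_Mapping.keys c \<subseteq> T" using c(1) by (auto simp: in_keys_iff)
    then show ?thesis using IH(6) c by blast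
  qed
  moreover have "card (insert v B) = Suc n" "Suc (card (insert e T)) = Suc n"
    using IH fin e \<open>e \<notin> T\<close> by auto
  ultimately show ?case
    using IH e by (intro exI[of _ "insert v B"] exI[of _ "insert e T"]) auto
qed

text \<open>
  A cycle is determined by its coefficients outside a spanning tree.
\<close>

lemma genus_le:
  assumes "Digraph_Component.connected G"
  shows "genus G + card (verts G) \<le> card (arcs G) + 1"
proof -
  have "verts G \<noteq> {}"
    using assms by (auto simp: Digraph_Component.connected_def strongly_connected_def)
  then have "1 \<le> card (verts G)" by (simp add: Suc_le_eq card_gt_0_iff)
  then obtain T where T: "T \<subseteq> arcs G" "Suc (card T) = card (verts G)"
    "\<And>c. Poly_Mapping.keys c \<subseteq> T \<Longrightarrow> boundary_map G c = 0 \<Longrightarrow> c = 0"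
    using spanning_tree_grows[OF assms, of "card (verts G)"] by auto
  let ?one = "\<lambda>e. Poly_Mapping.single e (1::real)"
  define p :: "('b \<Rightarrow>\<^sub>0 real) \<Rightarrow> ('b \<Rightarrow>\<^sub>0 real)"
    where "p c = (\<Sum>e\<in>arcs G - T. Poly_Mapping.lookup c e *\<^sub>R ?one e)" for c
  have "linear p"
    by (rule linearI) (simp_all add: p_def lookup_add scaleR_add_left sum.distrib scaleR_sum_right)
  have lookup_p: "Poly_Mapping.lookup (p c) e = Poly_Mapping.lookup c e" if "e \<in> arcs G - T" for c e
    unfolding p_def using that
    by (simp add: lookup_sum lookup_single when_def if_distrib sum.delta cong: if_cong)
  have sub: "subspace (cycle_space G)"
  proof (rule subspaceI)
    have bd: "c \<in> cycle_space G \<longleftrightarrow> Poly_Mapping.keys c \<subseteq> arcs G \<and>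
      (\<forall>v. (\<Sum>e\<in>arcs G. Poly_Mapping.lookup c e * (of_bool (head G e = v) - of_bool (tail G e = v))) = 0)" for c
      using lookup_boundary_map[OF finite_arcs, of c G]
      by (auto simp: cycle_space_def poly_mapping_eq_iff fun_eq_iff)
    show "0 \<in> cycle_space G" by (simp add: bd)
    show "x + y \<in> cycle_space G" if "x \<in> cycle_space G" "y \<in> cycle_space G" for x y
      using that keys_add[of x y] by (auto simp: bd lookup_add distrib_right sum.distrib)
    show "r *\<^sub>R x \<in> cycle_space G" if "x \<in> cycle_space G" for r x
      using that by (auto simp: bd in_keys_iff mult.assoc subset_iff simp flip: sum_distrib_left)
  qed
  have inj: "inj_on p (cycle_space G)"
  proof (rule inj_onI)
    fix x y assume xy: "x \<in> cycle_space G" "y \<in> cycle_space G" "p x = p y"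
    then have "x - y \<in> cycle_space G" using sub by (simp add: subspace_diff)
    then have c: "Poly_Mapping.keys (x - y) \<subseteq> arcs G" "boundary_map G (x - y) = 0"
      by (auto simp: cycle_space_def)
    have "Poly_Mapping.lookup (x - y) e = 0" if "e \<in> arcs G - T" for e
      using lookup_p[OF that, of x] lookup_p[OF that, of y] xy by (simp add: lookup_minus)
    then have "Poly_Mapping.keys (x - y) \<subseteq> T" using c(1) by (auto simp: in_keys_iff)
    then show "x = y" using T(3) c(2) by fastforce
  qed
  obtain X where X: "X \<subseteq> cycle_space G" "independent X" "card X = dim (cycle_space G)"
    using basis_exists[of "cycle_space G"] by metis
  have "span X \<subseteq> cycle_space G" using X sub by (simp add: span_minimal)
  then have "independent (p ` X)"
    using linear_independent_injective_image[OF \<open>linear p\<close> X(2)] inj inj_on_subset by blast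
  moreover have "p ` X \<subseteq> span (?one ` (arcs G - T))"
  proof (rule image_subsetI)
    show "p c \<in> span (?one ` (arcs G - T))" for c
      unfolding p_def by (intro span_sum span_scale) (simp add: span_base)
  qed
  ultimately have "card (p ` X) \<le> card (?one ` (arcs G - T))"
    using independent_span_bound[of "?one ` (arcs G - T)" "p ` X"] by simp
  also have "\<dots> \<le> card (arcs G - T)" by (simp add: card_image_le)
  also have "\<dots> = card (arcs G) - card T" using T by (simp add: card_Diff_subset finite_subset)
  finally have "card X \<le> card (arcs G) - card T"
    using card_image[of p X] inj X inj_on_subset by metis
  moreover have "card T \<le> card (arcs G)" using T by (simp add: card_mono)
  ultimately show ?thesis using X T by (simp add: genus_def)
qed

end

section \<open>Metric graphs\<close>

context metric_graph
begin

lemma route_nonneg: "route G len emb x y l \<Longrightarrow> 0 \<le> l"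
  by (induction rule: route.induct) auto

lemma route_single:
  assumes "e \<in> arcs G" "s \<in> {0..len e}" "t \<in> {0..len e}"
  shows "route G len emb (emb e s) (emb e t) \<bar>t - s\<bar>"
proof -
  have "route G len emb (emb e s) (emb e s) 0" by (rule route.refl)
  from route.step[OF this assms] show ?thesis by simp
qed

lemma route_trans: "route G len emb y z m \<Longrightarrow> route G len emb x y l \<Longrightarrow> \<exists>n. route G len emb x z n"
  by (induction rule: route.induct) (blast intro: route.step)+

lemma route_sym: "route G len emb x y l \<Longrightarrow> \<exists>m. route G len emb y x m"
proof (induction rule: route.induct)
  case (refl x)
  show ?case by (rule exI, rule route.refl)
next
  case (step x e s l t)
  then show ?case using route_trans route_single[of e t s] by blast
qed

lemma route_from_vertex:
  assumes u: "u \<in> verts G"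
  shows "\<exists>l. route G len emb u x l"
proof -
  define R where "R = {y \<in> verts G. \<exists>l. route G len emb u y l}"
  have ends: "head G e \<in> R \<longleftrightarrow> tail G e \<in> R" if e: "e \<in> arcs G" for e
  proof -
    have "route G len emb (tail G e) (head G e) \<bar>len e\<bar>" "route G len emb (head G e) (tail G e) \<bar>len e\<bar>"
      using route_single[OF e, of 0 "len e"] route_single[OF e, of "len e" 0]
        emb_tail[OF e] emb_head[OF e] len_pos[OF e] by auto
    then show ?thesis using e unfolding R_def by (auto dest: route_trans)
  qed
  have "route G len emb u u 0" by (rule route.refl)
  then have "u \<in> R" using u unfolding R_def by blast
  then have "R = verts G"
    using connected_imp_crossing_arc[OF graph_connected, of R] ends unfolding R_def by blast
  have "x \<in> verts G \<union> (\<Union>e\<in>arcs G. emb e ` {0..len e})" using covered by auto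
  then show ?thesis
  proof
    assume "x \<in> verts G" then show ?thesis using \<open>R = verts G\<close> by (auto simp: R_def)
  next
    assume "x \<in> (\<Union>e\<in>arcs G. emb e ` {0..len e})"
    then obtain e t where e: "e \<in> arcs G" "t \<in> {0..len e}" "x = emb e t" by auto
    then have "tail G e \<in> R" using \<open>R = verts G\<close> by simp
    then obtain l where "route G len emb u (emb e 0) l" using emb_tail[OF e(1)] by (auto simp: R_def)
    then show ?thesis using route.step[of G len emb u e 0 l t] e len_pos[OF e(1)] by auto
  qed
qed

lemma route_exists: "\<exists>l. route G len emb x y l"
proof -
  obtain u where "u \<in> verts G"
    using graph_connected by (auto simp: Digraph_Component.connected_def strongly_connected_def)
  then show ?thesis using route_from_vertex route_sym route_trans by meson
qed

text \<open>
  The bound adds up along every route, and the distance is the infimum of the lengths of routes.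
  That some route exists is essential here, and is where connectedness of the graph enters.
\<close>

lemma lipschitz_if_on_edges:
  fixes f :: "'a \<Rightarrow> real"
  assumes "\<And>e s t. e \<in> arcs G \<Longrightarrow> s \<in> {0..len e} \<Longrightarrow> t \<in> {0..len e} \<Longrightarrow>
      \<bar>f (emb e t) - f (emb e s)\<bar> \<le> \<bar>t - s\<bar>"
  shows "\<bar>f y - f x\<bar> \<le> dist x y"
proof -
  have "\<bar>f y - f x\<bar> \<le> l" if "route G len emb x y l" for l
    using that
  proof (induction rule: route.induct)
    case (step x e s l t)
    then show ?case using assms[of e s t] by linarith
  qed simp
  then show ?thesis
    unfolding dist_eq using route_exists[of x y] by (intro cInf_greatest) auto
qed

lemma continuous_on_emb:
  assumes e: "e \<in> arcs G"
  shows "continuous_on {0..len e} (emb e)"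
proof -
  have "dist (emb e s) (emb e t) \<le> dist s t" if "s \<in> {0..len e}" "t \<in> {0..len e}" for s t
    unfolding dist_eq[of "emb e s"] using route_single[OF e that]
    by (intro cInf_lower) (auto intro!: bdd_belowI[of _ 0] route_nonneg simp: dist_real_def abs_minus_commute)
  then show ?thesis
    unfolding continuous_on_iff by (meson order_le_less_trans)
qed

lemma emb_eq_interior:
  assumes "e \<in> arcs G" "t \<in> {0<..<len e}" "e' \<in> arcs G" "s \<in> {0..len e'}" "emb e' s = emb e t"
  shows "e' = e \<and> s = t"
proof -
  have "s \<in> {0<..<len e'}"
  proof (rule ccontr)
    assume "s \<notin> {0<..<len e'}"
    then have "s = 0 \<or> s = len e'" using assms by auto
    then have "emb e' s \<in> verts G"
      using emb_tail emb_head assms(3) by (metis head_in_verts tail_in_verts)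
    then show False using emb_interior assms by metis
  qed
  then show ?thesis using inj_onD[OF emb_inj, of "(e', s)" "(e, t)"] assms by auto
qed

lemma inj_on_emb:
  assumes "e \<in> arcs G" "0 \<le> a" "b \<le> len e" "0 < a \<or> b < len e"
  shows "inj_on (emb e) {a..b}"
proof (rule inj_onI)
  fix s t assume st: "s \<in> {a..b}" "t \<in> {a..b}" "emb e s = emb e t"
  consider "s \<in> {0<..<len e}" | "t \<in> {0<..<len e}" | "s \<in> {0, len e}" "t \<in> {0, len e}"
    using st assms by force
  then show "s = t"
  proof cases
    case 1
    then show ?thesis using emb_eq_interior[of e s e t] st assms by auto
  next
    case 2
    then show ?thesis using emb_eq_interior[of e t e s] st assms by auto
  next
    case 3
    then show ?thesis using st assms by auto
  qed
qed

text \<open>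
  The open segment is where a tent function supported on it is positive, and that function is
  continuous because it is 1-Lipschitz along every edge.
\<close>

lemma open_segment_of_edge:
  assumes e: "e \<in> arcs G" and ab: "0 \<le> a" "b \<le> len e"
  shows "open (emb e ` {a<..<b})"
proof -
  define f where "f x = (if x \<in> emb e ` {a<..<b}
    then (\<lambda>t. min (t - a) (b - t)) (inv_into {a<..<b} (emb e) x) else 0)" for x
  have inj: "inj_on (emb e) {a<..<b}"
  proof (rule inj_onI)
    fix s t assume "s \<in> {a<..<b}" "t \<in> {a<..<b}" "emb e s = emb e t"
    then show "s = t" using emb_eq_interior[of e t e s] e ab by auto
  qed
  have inside: "f (emb e t) = min (t - a) (b - t)" if "t \<in> {a<..<b}" for t
    using that inj by (simp add: f_def inv_into_f_f)
  have outside: "f (emb e' t) = 0" if "e' \<in> arcs G" "t \<in> {0..len e'}" "e' \<noteq> e \<or> t \<notin> {a<..<b}" for e' t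
  proof -
    have "emb e' t \<noteq> emb e s" if "s \<in> {a<..<b}" for s
      using emb_eq_interior[of e s e' t] that \<open>e' \<in> arcs G\<close> \<open>t \<in> {0..len e'}\<close>
        \<open>e' \<noteq> e \<or> t \<notin> {a<..<b}\<close> e ab by auto
    then have "emb e' t \<notin> emb e ` {a<..<b}" by blast
    then show ?thesis by (simp add: f_def)
  qed
  have tent: "f (emb e t) = max 0 (min (t - a) (b - t))" if "t \<in> {0..len e}" for t
    using inside[of t] outside[OF e that] by (cases "t \<in> {a<..<b}") auto
  have "\<bar>f y - f x\<bar> \<le> dist x y" for x y
  proof (rule lipschitz_if_on_edges)
    fix e' s t assume "e' \<in> arcs G" "s \<in> {0..len e'}" "t \<in> {0..len e'}"
    then show "\<bar>f (emb e' t) - f (emb e' s)\<bar> \<le> \<bar>t - s\<bar>"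
      using outside[of e' s] outside[of e' t] tent[of s] tent[of t]
      by (cases "e' = e") (auto simp: max_def min_def abs_if)
  qed
  then have "continuous_on UNIV f"
    unfolding continuous_on_iff dist_real_def by (metis dist_commute order_le_less_trans)
  then have "open {x. 0 < f x}" by (intro open_Collect_less continuous_intros)
  moreover have "{x. 0 < f x} = emb e ` {a<..<b}"
  proof (intro equalityI subsetI)
    fix x assume "x \<in> {x. 0 < f x}"
    then show "x \<in> emb e ` {a<..<b}" by (simp add: f_def split: if_splits)
  next
    fix x assume "x \<in> emb e ` {a<..<b}"
    then obtain t where "t \<in> {a<..<b}" "x = emb e t" by (rule imageE) simp
    then show "x \<in> {x. 0 < f x}" using inside[of t] by simp
  qed
  ultimately show ?thesis by simp
qed

text \<open>
  Cutting every edge at its midpoint turns each loop into two arcs with distinct ends.  The midpoints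
  add as many nodes as the cuts add edges.
\<close>

lemma exists_arc_decomposition:
  "\<exists>(W :: 'a set) S. arc_decomposition W S \<and> card S + card (verts G) = card W + card (arcs G)"
proof -
  \<comment> \<open>The pair \<open>(e, True)\<close> stands for the half of \<open>e\<close> next to the tail, \<open>(e, False)\<close> for the other half.\<close>
  define lo hi where "lo = (\<lambda>(e, i). if i then 0 else len e / 2)"
    and "hi = (\<lambda>(e, i). if i then len e / 2 else len e)"
  define half where "half h = subarc (lo h) (hi h) (emb (fst h))" for h :: "'e \<times> bool"
  define mid where "mid e = emb e (len e / 2)" for e
  define H where "H = arcs G \<times> (UNIV :: bool set)"
  let ?W = "verts G \<union> mid ` arcs G"
  have lohi: "0 \<le> lo h" "lo h < hi h" "hi h \<le> len (fst h)" "0 < lo h \<or> hi h < len (fst h)"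
    if "h \<in> H" for h
    using that len_pos[of "fst h"] by (auto simp: lo_def hi_def H_def split: prod.splits)
  have ends: "emb (fst h) (lo h) \<in> ?W" "emb (fst h) (hi h) \<in> ?W" if "h \<in> H" for h
    using that emb_tail emb_head by (auto simp: lo_def hi_def H_def mid_def)
  have oi: "open_image (half h) = emb (fst h) ` {lo h<..<hi h}" if "h \<in> H" for h
    using lohi[OF that] by (simp add: half_def open_image_subarc)
  have pim: "path_image (half h) = emb (fst h) ` {lo h..hi h}" if "h \<in> H" for h
    using lohi[OF that] by (simp add: half_def path_image_subarc)
  have disj: "open_image (half h) \<inter> open_image (half k) = {}" if hk: "h \<in> H" "k \<in> H" "h \<noteq> k" for h k
  proof (rule ccontr)
    assume "\<not> ?thesis"
    then have "emb (fst h) ` {lo h<..<hi h} \<inter> emb (fst k) ` {lo k<..<hi k} \<noteq> {}"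
      using oi hk by simp
    then obtain x where "x \<in> emb (fst h) ` {lo h<..<hi h}" "x \<in> emb (fst k) ` {lo k<..<hi k}"
      by blast
    then obtain s t where st: "s \<in> {lo h<..<hi h}" "t \<in> {lo k<..<hi k}" "emb (fst h) s = emb (fst k) t"
      by (elim imageE) metis
    then have "fst h = fst k \<and> s = t"
      using emb_eq_interior[of "fst k" t "fst h" s] lohi[of h] lohi[of k] hk by (auto simp: H_def)
    then show False using st hk by (auto simp: lo_def hi_def H_def split: if_splits)
  qed
  have inj_half: "inj_on half H"
  proof (rule inj_onI, rule ccontr)
    fix h k assume "h \<in> H" "k \<in> H" "half h = half k" "h \<noteq> k"
    then show False using disj[of h k] by auto
  qed
  have mid_in: "len e / 2 \<in> {0<..<len e}" if "e \<in> arcs G" for e using len_pos[OF that] by auto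
  have "arc_decomposition ?W (half ` H)"
  proof
    show "finite ?W" "finite (half ` H)" by (auto simp: H_def)
    show "Path_Connected.arc \<sigma>" if \<sigma>: "\<sigma> \<in> half ` H" for \<sigma>
    proof -
      obtain h where h: "h \<in> H" "\<sigma> = half h" using \<sigma> by auto
      then have "fst h \<in> arcs G" by (auto simp: H_def)
      then show ?thesis
        unfolding h(2) half_def using lohi[OF h(1)]
        by (intro arc_subarc continuous_on_subset[OF continuous_on_emb] inj_on_emb) auto
    qed
    show "pathstart \<sigma> \<in> ?W" "pathfinish \<sigma> \<in> ?W" if \<sigma>: "\<sigma> \<in> half ` H" for \<sigma>
    proof -
      obtain h where h: "h \<in> H" "\<sigma> = half h" using \<sigma> by (rule imageE) simp
      show "pathstart \<sigma> \<in> ?W" "pathfinish \<sigma> \<in> ?W"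
        unfolding h(2) half_def pathstart_subarc pathfinish_subarc by (rule ends[OF h(1)])+
    qed
    show "open (open_image \<sigma>)" if \<sigma>: "\<sigma> \<in> half ` H" for \<sigma>
    proof -
      obtain h where h: "h \<in> H" "\<sigma> = half h" using \<sigma> by auto
      then have "fst h \<in> arcs G" by (auto simp: H_def)
      then show ?thesis using h lohi[OF h(1)] by (simp add: oi open_segment_of_edge)
    qed
    show "open_image \<sigma> \<inter> ?W = {}" if \<sigma>: "\<sigma> \<in> half ` H" for \<sigma>
    proof (rule ccontr)
      assume *: "\<not> ?thesis"
      obtain h where h: "h \<in> H" "\<sigma> = half h" using \<sigma> by auto
      have e: "fst h \<in> arcs G" using h by (auto simp: H_def)
      obtain x where "x \<in> emb (fst h) ` {lo h<..<hi h}" "x \<in> ?W"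
        using * unfolding h(2) oi[OF h(1)] by blast
      then obtain t where t: "t \<in> {lo h<..<hi h}" "emb (fst h) t \<in> ?W" by (elim imageE) simp
      then have t': "t \<in> {0<..<len (fst h)}" using lohi[OF h(1)] by auto
      then have "emb (fst h) t \<notin> verts G" by (rule emb_interior[OF e])
      then obtain e' where "e' \<in> arcs G" "emb (fst h) t = emb e' (len e' / 2)"
        using t by (auto simp: mid_def)
      then have "fst h = e' \<and> t = len e' / 2"
        using emb_eq_interior[of e' "len e' / 2" "fst h" t] mid_in e t' by auto
      then show False using t by (auto simp: lo_def hi_def split: prod.splits if_splits)
    qed
    show "open_image \<sigma> \<inter> open_image \<tau> = {}"
      if "\<sigma> \<in> half ` H" "\<tau> \<in> half ` H" "\<sigma> \<noteq> \<tau>" for \<sigma> \<tau>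
      using that disj by blast
    have "emb e ` {0..len e} \<subseteq> (\<Union>\<sigma>\<in>half ` H. path_image \<sigma>)" if e: "e \<in> arcs G" for e
    proof -
      have "{0..len e} = {lo (e, True)..hi (e, True)} \<union> {lo (e, False)..hi (e, False)}"
        using mid_in[OF e] by (auto simp: lo_def hi_def)
      then have "emb e ` {0..len e} = path_image (half (e, True)) \<union> path_image (half (e, False))"
        using e by (simp add: pim H_def image_Un)
      then show ?thesis using e by (auto simp: H_def)
    qed
    then have "(\<Union>e\<in>arcs G. emb e ` {0..len e}) \<subseteq> (\<Union>\<sigma>\<in>half ` H. path_image \<sigma>)" by (rule UN_least)
    then have "verts G \<union> (\<Union>e\<in>arcs G. emb e ` {0..len e}) \<subseteq> ?W \<union> (\<Union>\<sigma>\<in>half ` H. path_image \<sigma>)"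
      by (intro Un_mono Un_upper1)
    then show "?W \<union> (\<Union>\<sigma>\<in>half ` H. path_image \<sigma>) = UNIV" unfolding covered by (rule top.extremum_uniqueI)
  qed
  moreover have "card (half ` H) = 2 * card (arcs G)"
    using card_image[OF inj_half] by (simp add: H_def card_cartesian_product)
  moreover have "card ?W = card (verts G) + card (arcs G)"
  proof -
    have "inj_on mid (arcs G)"
    proof (rule inj_onI)
      fix e e' assume "e \<in> arcs G" "e' \<in> arcs G" "mid e = mid e'"
      then show "e = e'"
        using emb_eq_interior[of e' "len e' / 2" e "len e / 2"] mid_in[of e] mid_in[of e']
        by (auto simp: mid_def)
    qed
    moreover have "verts G \<inter> mid ` arcs G = {}"
      using emb_interior mid_in by (auto simp: mid_def)
    ultimately show ?thesis by (simp add: card_Un_disjoint card_image)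
  qed
  ultimately show ?thesis by (intro exI[of _ ?W] exI[of _ "half ` H"]) simp
qed

end

section \<open>Adding a chip to a reduced divisor\<close>

theorem theorem1p13:
  fixes G :: "('a::metric_space, 'e) pre_digraph"
    and len :: "'e \<Rightarrow> real"
    and emb :: "'e \<Rightarrow> real \<Rightarrow> 'a"
    and v\<^sub>0 :: 'a
    and D :: "'a divisor"
  assumes "metric_graph G len emb"
    and "genus G \<ge> 2"
    and "v0_reduced v\<^sub>0 D"
    and "divisor_degree D - Poly_Mapping.lookup D v\<^sub>0 \<le> int (genus G) - 1"
  shows "\<exists>w. w \<noteq> v\<^sub>0 \<and> v0_reduced v\<^sub>0 (D + frag_of w)"
proof -
  interpret metric_graph G len emb by fact
  let ?d = "Poly_Mapping.lookup D" and ?X = "insert v\<^sub>0 (Poly_Mapping.keys D)"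
  obtain W\<^sub>1 :: "'a set" and S\<^sub>1 where 1: "arc_decomposition W\<^sub>1 S\<^sub>1"
      "card S\<^sub>1 + card (verts G) = card W\<^sub>1 + card (arcs G)"
    using exists_arc_decomposition by blast
  obtain W S where 2: "arc_decomposition W S" "?X \<union> W\<^sub>1 \<subseteq> W"
      "card S + card W\<^sub>1 = card S\<^sub>1 + card W"
    using refine_at_finite_set[OF _ 1(1), of ?X] by auto
  interpret arc_decomposition W S by fact
  have v0: "v\<^sub>0 \<in> W" and supp: "Poly_Mapping.keys D \<subseteq> W" using 2 by auto
  have "divisor_degree D = sum ?d W"
    unfolding divisor_degree_def using finite_nodes supp
    by (intro sum.mono_neutral_left) (auto simp: in_keys_iff)
  then have "sum ?d (W - {v\<^sub>0}) = divisor_degree D - ?d v\<^sub>0"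
    using finite_nodes v0 by (simp add: sum_diff1)
  moreover have "int (genus G) + int (card W) \<le> int (card S) + 1"
    using 1(2) 2(3) genus_le[OF graph_connected] by linarith
  moreover have "card (edges_within W) = card S"
    using edge_start edge_finish unfolding edges_within_def
    by (intro arg_cong[where f = card]) auto
  ultimately have "sum ?d (W - {v\<^sub>0}) + int (card W) - 1 < int (card (edges_within W))"
    using assms(4) by linarith
  then obtain w where w: "w \<in> W - {v\<^sub>0}" "burnt v\<^sub>0 (?d(w := ?d w + 1)) W"
    using burnt_add_chip[OF reduced_imp_burnt[OF v0 assms(3)]] by auto
  \<comment> \<open>The same order of burning serves the divisor with the extra chip.\<close>
  have lookup: "Poly_Mapping.lookup (D + frag_of w) = ?d(w := ?d w + 1)"
    by (auto simp: lookup_add)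
  have "v0_reduced v\<^sub>0 (D + frag_of w)"
  proof (rule burnt_imp_reduced[OF v0])
    show "Poly_Mapping.keys (D + frag_of w) \<subseteq> W"
      using keys_add[of D "frag_of w"] supp w by auto
    show "0 \<le> Poly_Mapping.lookup (D + frag_of w) v" if "v \<noteq> v\<^sub>0" for v
      using assms(3) that by (auto simp: lookup v0_reduced_def)
    show "burnt v\<^sub>0 (Poly_Mapping.lookup (D + frag_of w)) W" unfolding lookup by (rule w(2))
  qed
  then show ?thesis using w by blast
qed

end
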